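(* If $G$ is a graph with minimum degree $\delta(G) = 2$ that does not contain a universal vertex, then $c_{\min}(G) = 4$ if and only if $G\in \mathcal{F}$.
   Context: Graphs are finite, simple and undirected, with nonempty vertex set. A vertex $v$ is universal if it is adjacent to all other vertices of $G$. A set $S\subseteq V(G)$ is a dominating set of $G$ if every vertex of $V(G)\setminus S$ is adjacent to a vertex of $S$. All parts of a partition are nonempty. Two disjoint sets $X,Y\subseteq V(G)$ form a coalition in $G$ if neither $X$ nor $Y$ is a dominating set of $G$ but $X\cup Y$ is a dominating set of $G$. A $c$-partition of $G$ is a partition $\{V_1,\ldots,V_k\}$ of $V(G)$ such that each $V_i$ either is a dominating set consisting of a single vertex, or forms a coalition with some other set $V_j$ ($j\neq i$) of the partition. For partitions $\mathcal{A},\mathcal{B}$ of $V(G)$, $\mathcal{B}$ is a refinement of $\mathcal{A}$ if every set of $\mathcal{B}$ is equal to or a proper subset of some set of $\mathcal{A}$; it is a proper refinement if moreover $\mathcal{A}\ne\mathcal{B}$. A $c$-partition is minimal if it is not a proper refinement of any other $c$-partition of $G$. The minmin coalition number $c_{\min}(G)$ is the minimum number of sets in a minimal $c$-partition of $G$. $\mathcal{F}$ is the family of graphs $G$ whose vertex set can be written as $V(G)=\{v,x,y\}\cup U$, with $v,x,y$ distinct and not in $U$, such that $\deg(v)=2$ and $N(v)=\{x,y\}$ (where $N(v)$ is the set of neighbors of $v$), the vertices $x$ and $y$ are not adjacent, and both $x$ and $y$ are adjacent to all vertices of $U$. The subgraph $G[U]$ induced by $U$ may contain any number of edges, including none. 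*)

theory Defs
  imports "Graph_Theory.Digraph" "HOL-Library.Disjoint_Sets"
begin

text \<open>
  Finite simple undirected graphs are the locale \<^locale>\<open>graph\<close> of \<open>Graph_Theory\<close>: finite
  loop-free symmetric digraphs without parallel arcs, so an undirected edge \<open>uv\<close> is a pair of
  opposite arcs and \<open>u \<rightarrow>\<^bsub>G\<^esub> v\<close> is adjacency. The locale admits the null graph, so nonemptiness of
  the vertex set has to be assumed separately.
\<close>

definition neighborhood :: "('a, 'b) pre_digraph \<Rightarrow> 'a \<Rightarrow> 'a set" where
  "neighborhood G v = {u \<in> verts G. v \<rightarrow>\<^bsub>G\<^esub> u}"

definition degree :: "('a, 'b) pre_digraph \<Rightarrow> 'a \<Rightarrow> nat" where
  "degree G v = card (neighborhood G v)"

definition min_degree :: "('a, 'b) pre_digraph \<Rightarrow> nat" where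
  "min_degree G = Min (degree G ` verts G)"

definition universal_vertex :: "('a, 'b) pre_digraph \<Rightarrow> 'a \<Rightarrow> bool" where
  "universal_vertex G v \<longleftrightarrow> v \<in> verts G \<and> (\<forall>u \<in> verts G - {v}. v \<rightarrow>\<^bsub>G\<^esub> u)"

definition dominating_set :: "('a, 'b) pre_digraph \<Rightarrow> 'a set \<Rightarrow> bool" where
  "dominating_set G S \<longleftrightarrow> S \<subseteq> verts G \<and> (\<forall>u \<in> verts G - S. \<exists>s \<in> S. u \<rightarrow>\<^bsub>G\<^esub> s)"

definition coalition :: "('a, 'b) pre_digraph \<Rightarrow> 'a set \<Rightarrow> 'a set \<Rightarrow> bool" where
  "coalition G X Y \<longleftrightarrow>
     X \<subseteq> verts G \<and> Y \<subseteq> verts G \<and> X \<inter> Y = {} \<and>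
     \<not> dominating_set G X \<and> \<not> dominating_set G Y \<and> dominating_set G (X \<union> Y)"

definition c_partition :: "('a, 'b) pre_digraph \<Rightarrow> 'a set set \<Rightarrow> bool" where
  "c_partition G P \<longleftrightarrow>
     partition_on (verts G) P \<and>
     (\<forall>X \<in> P. (dominating_set G X \<and> card X = 1) \<or> (\<exists>Y \<in> P - {X}. coalition G X Y))"

text \<open>
  \<open>refines A P Q\<close> says that \<open>P\<close> is the finer partition, so the minimal \<open>c\<close>-partitions are the
  coarsest ones.
\<close>

definition minimal_c_partition :: "('a, 'b) pre_digraph \<Rightarrow> 'a set set \<Rightarrow> bool" where
  "minimal_c_partition G P \<longleftrightarrow>
     c_partition G P \<and> \<not> (\<exists>Q. c_partition G Q \<and> refines (verts G) P Q \<and> P \<noteq> Q)"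

text \<open>
  On \<^typ>\<open>nat\<close>, \<open>Inf\<close> of a nonempty set is its minimum (and \<open>Inf {} = 0\<close>).
\<close>

definition c_min :: "('a, 'b) pre_digraph \<Rightarrow> nat" where
  "c_min G = Inf (card ` {P. minimal_c_partition G P})"

definition family_F :: "('a, 'b) pre_digraph set" where
  "family_F = {G. graph G \<and>
     (\<exists>v x y U. verts G = {v, x, y} \<union> U \<and>
        v \<noteq> x \<and> v \<noteq> y \<and> x \<noteq> y \<and> v \<notin> U \<and> x \<notin> U \<and> y \<notin> U \<and>
        degree G v = 2 \<and> neighborhood G v = {x, y} \<and>
        \<not> x \<rightarrow>\<^bsub>G\<^esub> y \<and>
        (\<forall>u \<in> U. x \<rightarrow>\<^bsub>G\<^esub> u \<and> y \<rightarrow>\<^bsub>G\<^esub> u))}"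

end

theory Submission
  imports Defs "Graph_Theory.Digraph_Component"
begin

text \<open>
  Every \<open>c\<close>-partition with the fewest parts is automatically minimal, because passing to a
  proper coarsening lowers the number of parts. So \<^const>\<open>c_min\<close> is the least number of parts of
  any \<open>c\<close>-partition, and minimality disappears from the problem
  (\<open>c_min_eq_least_card_c_partition\<close>).

  A set dominates exactly when it meets all closed neighborhoods. Hence a part fails to dominate
  when it misses some closed neighborhood, and small \<open>c\<close>-partitions amount to closed
  neighborhoods with empty intersection. If two of them are disjoint, splitting the vertices along
  one of the two gives a \<open>c\<close>-partition with two parts. If they intersect pairwise but
  three of them have no common vertex, distributing each vertex to a neighborhood that misses it
  gives a \<open>c\<close>-partition with three parts (\<open>c_partition_of_three_closed_neighborhoods\<close>). So if \<open>c_min G = 4\<close>, any three closed neighborhoods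
  have a common vertex (\<open>closed_neighborhoods_intersect\<close>). Apply this to the closed
  neighborhood \<open>{v, x, y}\<close> of a vertex of degree 2: a vertex outside it that is not adjacent to \<open>x\<close>
  would leave \<open>y\<close> as the only candidate for a common vertex with any third closed neighborhood,
  which would make \<open>y\<close> universal. So \<open>x\<close> and, by symmetry, \<open>y\<close> are adjacent to all other
  vertices, and they are not adjacent to each other since neither is universal.

  Conversely, in a graph of the family \<open>x\<close> together with any other vertex dominates, and so does
  \<open>y\<close>. Therefore \<open>{x}\<close> and \<open>{y}\<close> are parts of every \<open>c\<close>-partition, and the remaining vertices
  \<open>{v} \<union> U\<close> form a dominating set, so they must be split. This gives at least four
  parts, and \<open>{v}\<close>, \<open>{x}\<close>, \<open>{y}\<close>, \<open>U\<close> attain the bound.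
\<close>

section \<open>Coarsest partitions and the minmin coalition number\<close>

lemma refines_eq_if_card_le:
  assumes ref: "refines A P Q" and fin: "finite A" and le: "card P \<le> card Q"
  shows "P = Q"
proof -
  have P: "partition_on A P" and Q: "partition_on A Q"
    and sub: "\<And>X. X \<in> P \<Longrightarrow> \<exists>Y\<in>Q. X \<subseteq> Y"
    using ref unfolding refines_def by auto
  have finP: "finite P" and finQ: "finite Q"
    using finite_elements[OF fin] P Q by auto
  have Q_eq: "Y = Y'" if "Y \<in> Q" "Y' \<in> Q" "a \<in> Y" "a \<in> Y'" for Y Y' a
    using partition_onD2[OF Q] that unfolding disjoint_def by blast
  have "\<exists>X\<in>P. X \<subseteq> Y" if Y: "Y \<in> Q" for Y
  proof -
    obtain a where a: "a \<in> Y" using partition_onD3[OF Q] Y by fastforce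
    then obtain X where X: "X \<in> P" "a \<in> X"
      using partition_onD1[OF P] partition_onD1[OF Q] Y by blast
    then show ?thesis using sub Q_eq[OF Y _ a] by blast
  qed
  then obtain f where f: "\<And>Y. Y \<in> Q \<Longrightarrow> f Y \<in> P" "\<And>Y. Y \<in> Q \<Longrightarrow> f Y \<subseteq> Y"
    by metis
  have f_ne: "f Y \<noteq> {}" if "Y \<in> Q" for Y
    using f(1)[OF that] partition_onD3[OF P] by auto
  have inj: "inj_on f Q"
  proof (rule inj_onI)
    fix Y Y' assume YY': "Y \<in> Q" "Y' \<in> Q" "f Y = f Y'"
    then obtain a where "a \<in> f Y" using f_ne by blast
    then show "Y = Y'" using Q_eq f(2) YY' by blast
  qed
  \<comment> \<open>Each block of \<open>Q\<close> contains a block of \<open>P\<close>; by counting, it contains only one.\<close>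
  have img: "f ` Q = P"
    by (rule card_seteq[OF finP]) (use f(1) le inj in \<open>auto simp: card_image\<close>)
  have "f Y = Y" if Y: "Y \<in> Q" for Y
  proof
    show "f Y \<subseteq> Y" by (rule f(2)[OF Y])
    show "Y \<subseteq> f Y"
    proof
      fix a assume a: "a \<in> Y"
      then obtain X where X: "X \<in> P" "a \<in> X"
        using partition_onD1[OF P] partition_onD1[OF Q] Y by blast
      then obtain Y' where "Y' \<in> Q" "X = f Y'" using img by blast
      then show "a \<in> f Y" using Q_eq[OF Y _ a] f(2) X by blast
    qed
  qed
  then show ?thesis using img by simp
qed

lemma (in graph) least_card_c_partition_is_minimal:
  assumes P: "c_partition G P" and least: "\<And>Q. c_partition G Q \<Longrightarrow> card P \<le> card Q"
  shows "minimal_c_partition G P"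
  unfolding minimal_c_partition_def
  using P least refines_eq_if_card_le[OF _ finite_verts] by blast

text \<open>
  If there is no \<open>c\<close>-partition, both sides are \<open>Inf {}\<close>, so existence is not an issue.
\<close>

lemma (in graph) c_min_eq_least_card_c_partition:
  "c_min G = Inf (card ` {P. c_partition G P})"
proof (cases "\<exists>P. c_partition G P")
  case False
  then show ?thesis by (simp add: c_min_def minimal_c_partition_def)
next
  case True
  then obtain P where P: "c_partition G P"
    and least: "\<And>Q. c_partition G Q \<Longrightarrow> card P \<le> card Q"
    using ex_has_least_nat[of "c_partition G" _ card] by blast
  have "Inf (card ` {P. c_partition G P}) = card P"
    by (rule cInf_eq_minimum) (use P least in auto)
  moreover have "Inf (card ` {P. minimal_c_partition G P}) = card P"
    by (rule cInf_eq_minimum)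
      (use least_card_c_partition_is_minimal[OF P least] least
        in \<open>auto simp: minimal_c_partition_def\<close>)
  ultimately show ?thesis by (simp add: c_min_def)
qed

section \<open>Domination and closed neighborhoods\<close>

definition closed_neighborhood :: "('a, 'b) pre_digraph \<Rightarrow> 'a \<Rightarrow> 'a set" where
  "closed_neighborhood G v = insert v (neighborhood G v)"

lemma dominating_set_iff_meets_closed_neighborhoods:
  assumes "S \<subseteq> verts G"
  shows "dominating_set G S \<longleftrightarrow> (\<forall>u \<in> verts G. closed_neighborhood G u \<inter> S \<noteq> {})"
  using assms unfolding dominating_set_def closed_neighborhood_def neighborhood_def by blast

lemma dominating_set_mono:
  assumes "dominating_set G S" "S \<subseteq> T" "T \<subseteq> verts G"
  shows "dominating_set G T"
  using assms unfolding dominating_set_def by blast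

lemma closed_neighborhood_subset_verts:
  "u \<in> verts G \<Longrightarrow> closed_neighborhood G u \<subseteq> verts G"
  by (auto simp: closed_neighborhood_def neighborhood_def)

lemma (in graph) closed_neighborhood_sym:
  assumes "u \<in> verts G" "w \<in> closed_neighborhood G u"
  shows "u \<in> closed_neighborhood G w"
  using assms graph_symmetric by (auto simp: closed_neighborhood_def neighborhood_def)

lemma (in graph) universal_vertex_iff_mem_closed_neighborhoods:
  "universal_vertex G v \<longleftrightarrow> v \<in> verts G \<and> (\<forall>u \<in> verts G. v \<in> closed_neighborhood G u)"
  using graph_symmetric
  by (auto simp: universal_vertex_def closed_neighborhood_def neighborhood_def)

lemma (in graph) dominating_singleton_imp_universal_vertex:
  "dominating_set G {v} \<Longrightarrow> universal_vertex G v"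
  using graph_symmetric by (auto simp: dominating_set_def universal_vertex_def)

text \<open>
  A member of a coalition does not dominate, and a single dominating vertex would be universal.
\<close>

lemma (in graph) c_partition_part_not_dominating:
  assumes no_universal: "\<not> (\<exists>v. universal_vertex G v)"
    and P: "c_partition G P" and X: "X \<in> P"
  shows "\<not> dominating_set G X"
proof
  assume dom: "dominating_set G X"
  then have "card X = 1"
    using P X unfolding c_partition_def coalition_def by blast
  then obtain v where v: "X = {v}" by (rule card_1_singletonE)
  then show False
    using dom dominating_singleton_imp_universal_vertex no_universal by blast
qed

section \<open>Partitions from closed neighborhoods without a common vertex\<close>

lemma c_partition_of_disjoint_closed_neighborhoods:
  assumes u: "u \<in> verts G" and w: "w \<in> verts G"
    and disj: "closed_neighborhood G u \<inter> closed_neighborhood G w = {}"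
  shows "\<exists>P. c_partition G P \<and> card P = 2"
proof -
  define A where "A = closed_neighborhood G u"
  define B where "B = verts G - A"
  have sub: "A \<subseteq> verts G" "B \<subseteq> verts G" "A \<union> B = verts G" "A \<inter> B = {}"
    using closed_neighborhood_subset_verts[OF u] by (auto simp: A_def B_def)
  have "u \<in> A" "w \<in> B"
    using w disj by (auto simp: A_def B_def closed_neighborhood_def)
  then have ne: "A \<noteq> {}" "B \<noteq> {}" "A \<noteq> B" using sub by auto
  have "\<not> dominating_set G A" "\<not> dominating_set G B"
    using disj u w sub by (auto simp: dominating_set_iff_meets_closed_neighborhoods A_def B_def)
  moreover have "dominating_set G (verts G)" by (simp add: dominating_set_def)
  ultimately have "coalition G A B" "coalition G B A"
    using sub by (auto simp: coalition_def Un_commute Int_commute)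
  moreover have "partition_on (verts G) {A, B}"
    using sub ne by (intro partition_onI) (auto simp: disjnt_def)
  ultimately have "c_partition G {A, B}"
    using ne unfolding c_partition_def by auto
  then show ?thesis using ne by (intro exI[of _ "{A, B}"]) simp
qed

text \<open>
  Each vertex is put into the part of a neighborhood that does not contain it. The part belonging
  to \<open>a\<close> then misses the closed neighborhood of \<open>a\<close>, hence does not dominate. The other two parts
  together cover this closed neighborhood, so their union meets every closed neighborhood.
\<close>

lemma c_partition_of_three_closed_neighborhoods:
  assumes abc: "a \<in> verts G" "b \<in> verts G" "c \<in> verts G"
    and meet: "\<And>u w. u \<in> verts G \<Longrightarrow> w \<in> verts G \<Longrightarrow>
      closed_neighborhood G u \<inter> closed_neighborhood G w \<noteq> {}"
    and empty: "closed_neighborhood G a \<inter> closed_neighborhood G b \<inter> closed_neighborhood G c = {}"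
  shows "\<exists>P. c_partition G P \<and> card P = 3"
proof -
  let ?N = "closed_neighborhood G"
  define A where "A = verts G - ?N a"
  define B where "B = ?N a - ?N b"
  define C where "C = ?N a \<inter> ?N b"
  have sub: "A \<subseteq> verts G" "B \<subseteq> verts G" "C \<subseteq> verts G" "A \<union> B \<union> C = verts G"
    and disj: "A \<inter> B = {}" "A \<inter> C = {}" "B \<inter> C = {}"
    using closed_neighborhood_subset_verts[of _ G] abc by (auto simp: A_def B_def C_def)
  have miss: "?N a \<inter> A = {}" "?N b \<inter> B = {}" "?N c \<inter> C = {}"
    using empty by (auto simp: A_def B_def C_def)
  have ne: "A \<noteq> {}" "B \<noteq> {}" "C \<noteq> {}"
  proof -
    \<comment> \<open>A common vertex of two of the neighborhoods lies outside the third, so in its part.\<close>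
    show "A \<noteq> {}"
      using meet[OF abc(2,3)] empty closed_neighborhood_subset_verts[OF abc(2)]
      by (auto simp: A_def)
    show "B \<noteq> {}" using meet[OF abc(1,3)] empty by (auto simp: B_def)
    show "C \<noteq> {}" using meet[OF abc(1,2)] by (auto simp: C_def)
  qed
  have neq: "A \<noteq> B" "A \<noteq> C" "B \<noteq> C" using ne disj by auto
  have nondom: "\<not> dominating_set G A" "\<not> dominating_set G B" "\<not> dominating_set G C"
    using miss abc sub by (auto simp: dominating_set_iff_meets_closed_neighborhoods)
  have dom: "dominating_set G S" if "S \<subseteq> verts G" "w \<in> verts G" "?N w \<subseteq> S" for S w
    using that meet[OF _ that(2)]
    by (force simp: dominating_set_iff_meets_closed_neighborhoods)
  have "dominating_set G (A \<union> B)"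
    using sub(1,2,4) miss(3) closed_neighborhood_subset_verts[OF abc(3)]
    by (intro dom[OF _ abc(3)]) auto
  moreover have "dominating_set G (B \<union> C)"
    using sub(2-4) miss(1) closed_neighborhood_subset_verts[OF abc(1)]
    by (intro dom[OF _ abc(1)]) auto
  ultimately have "coalition G A B" "coalition G B A" "coalition G C B"
    using sub(1-3) disj nondom unfolding coalition_def by (simp_all add: Un_commute Int_commute)
  moreover have "partition_on (verts G) {A, B, C}"
    using sub ne disj by (intro partition_onI) (auto simp: disjnt_def)
  ultimately have "c_partition G {A, B, C}"
    using neq unfolding c_partition_def by auto
  then show ?thesis using neq by (intro exI[of _ "{A, B, C}"]) simp
qed

lemma closed_neighborhoods_intersect:
  assumes large: "\<And>P. c_partition G P \<Longrightarrow> 4 \<le> card P"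
    and "a \<in> verts G" "b \<in> verts G" "c \<in> verts G"
  shows "closed_neighborhood G a \<inter> closed_neighborhood G b \<inter> closed_neighborhood G c \<noteq> {}"
proof
  assume empty: "closed_neighborhood G a \<inter> closed_neighborhood G b \<inter> closed_neighborhood G c = {}"
  have "closed_neighborhood G u \<inter> closed_neighborhood G w \<noteq> {}"
    if "u \<in> verts G" "w \<in> verts G" for u w
    using c_partition_of_disjoint_closed_neighborhoods[OF that] large by fastforce
  then obtain P where "c_partition G P" "card P = 3"
    using c_partition_of_three_closed_neighborhoods[OF assms(2-4) _ empty] by blast
  then show False using large by fastforce
qed

section \<open>Graphs of the family\<close>

text \<open>
  The closed neighborhoods of \<open>v\<close> and of a vertex \<open>u\<close> not adjacent to \<open>x\<close> can share only \<open>y\<close>. The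
  third closed neighborhood in the hypothesis is arbitrary, so \<open>y\<close> lies in all of them, that is,
  \<open>y\<close> is universal.
\<close>

lemma (in graph) adjacent_if_closed_neighborhoods_intersect:
  assumes no_universal: "\<not> (\<exists>v. universal_vertex G v)"
    and meet: "\<And>a b c. a \<in> verts G \<Longrightarrow> b \<in> verts G \<Longrightarrow> c \<in> verts G \<Longrightarrow>
      closed_neighborhood G a \<inter> closed_neighborhood G b \<inter> closed_neighborhood G c \<noteq> {}"
    and v: "v \<in> verts G" and xy: "neighborhood G v = {x, y}"
    and u: "u \<in> verts G" "u \<notin> {v, x, y}"
  shows "x \<rightarrow>\<^bsub>G\<^esub> u"
proof (rule ccontr)
  assume "\<not> x \<rightarrow>\<^bsub>G\<^esub> u"
  then have x: "x \<notin> closed_neighborhood G u"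
    using u graph_symmetric by (auto simp: closed_neighborhood_def neighborhood_def)
  have v': "v \<notin> closed_neighborhood G u"
    using u v xy closed_neighborhood_sym[of u v] by (auto simp: closed_neighborhood_def)
  have "y \<in> closed_neighborhood G w" if "w \<in> verts G" for w
    using meet[OF v u(1) that] x v' xy by (auto simp: closed_neighborhood_def)
  moreover have "y \<in> verts G" using xy by (auto simp: neighborhood_def)
  ultimately show False
    using no_universal universal_vertex_iff_mem_closed_neighborhoods by blast
qed

lemma (in graph) family_F_if_closed_neighborhoods_intersect:
  assumes no_universal: "\<not> (\<exists>v. universal_vertex G v)"
    and meet: "\<And>a b c. a \<in> verts G \<Longrightarrow> b \<in> verts G \<Longrightarrow> c \<in> verts G \<Longrightarrow>
      closed_neighborhood G a \<inter> closed_neighborhood G b \<inter> closed_neighborhood G c \<noteq> {}"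
    and v: "v \<in> verts G" and deg: "degree G v = 2"
  shows "G \<in> family_F"
proof -
  obtain x y where xy: "neighborhood G v = {x, y}" "x \<noteq> y"
    using deg unfolding degree_def card_2_iff by blast
  then have yx: "neighborhood G v = {y, x}" by blast
  define U where "U = verts G - {v, x, y}"
  have adj: "v \<rightarrow>\<^bsub>G\<^esub> x" "v \<rightarrow>\<^bsub>G\<^esub> y" and in_verts: "x \<in> verts G" "y \<in> verts G"
    using xy by (auto simp: neighborhood_def)
  have "v \<noteq> x" "v \<noteq> y" using adj adj_not_same by auto
  moreover have "x \<rightarrow>\<^bsub>G\<^esub> u" "y \<rightarrow>\<^bsub>G\<^esub> u" if "u \<in> U" for u
    using adjacent_if_closed_neighborhoods_intersect[OF no_universal meet v xy(1), of u]
      adjacent_if_closed_neighborhoods_intersect[OF no_universal meet v yx, of u] that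
    by (auto simp: U_def)
  moreover from this have "\<not> x \<rightarrow>\<^bsub>G\<^esub> y"
    using no_universal in_verts(1) graph_symmetric[OF adj(1)]
    unfolding universal_vertex_def U_def by blast
  moreover have "verts G = {v, x, y} \<union> U" "v \<notin> U" "x \<notin> U" "y \<notin> U"
    using v in_verts by (auto simp: U_def)
  ultimately show ?thesis
    unfolding family_F_def mem_Collect_eq
    using deg xy graph_axioms by blast
qed

text \<open>
  If a vertex dominates together with any other vertex, no part can contain it and a second
  vertex.
\<close>

lemma (in graph) c_partition_singleton_part:
  assumes no_universal: "\<not> (\<exists>v. universal_vertex G v)" and P: "c_partition G P"
    and x: "x \<in> verts G"
    and dom: "\<And>z. z \<in> verts G \<Longrightarrow> z \<noteq> x \<Longrightarrow> dominating_set G {x, z}"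
  shows "{x} \<in> P"
proof -
  have part: "partition_on (verts G) P" using P by (simp add: c_partition_def)
  then obtain X where X: "X \<in> P" "x \<in> X" using x partition_onD1 by blast
  have sub: "X \<subseteq> verts G" using X partition_onD1[OF part] by blast
  have "z = x" if z: "z \<in> X" for z
  proof (rule ccontr)
    assume "z \<noteq> x"
    then have "dominating_set G X"
      using dominating_set_mono[of G "{x, z}" X] dom[of z] sub X z by blast
    then show False using c_partition_part_not_dominating[OF no_universal P X(1)] by simp
  qed
  then have "X = {x}" using X by blast
  then show ?thesis using X by simp
qed

lemma (in graph) c_min_eq_4_if_family_F:
  assumes no_universal: "\<not> (\<exists>v. universal_vertex G v)" and F: "G \<in> family_F"
  shows "c_min G = 4"
proof -
  obtain v x y U where V: "verts G = {v, x, y} \<union> U"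
    and distinct: "v \<noteq> x" "v \<noteq> y" "x \<noteq> y" "v \<notin> U" "x \<notin> U" "y \<notin> U"
    and Nv: "neighborhood G v = {x, y}" and nxy: "\<not> x \<rightarrow>\<^bsub>G\<^esub> y"
    and xU: "\<And>u. u \<in> U \<Longrightarrow> x \<rightarrow>\<^bsub>G\<^esub> u" and yU: "\<And>u. u \<in> U \<Longrightarrow> y \<rightarrow>\<^bsub>G\<^esub> u"
    using F unfolding family_F_def by blast
  have vx: "v \<rightarrow>\<^bsub>G\<^esub> x" and vy: "v \<rightarrow>\<^bsub>G\<^esub> y" using Nv by (auto simp: neighborhood_def)
  note adj = vx vy xU yU vx[THEN graph_symmetric] vy[THEN graph_symmetric]
    xU[THEN graph_symmetric] yU[THEN graph_symmetric]
  have "U \<noteq> {}"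
    using no_universal vx vy V by (auto simp: universal_vertex_def)
  have dom_x: "dominating_set G {x, z}" if "z \<in> verts G" "z \<noteq> x" for z
    using that V adj by (auto simp: dominating_set_def)
  have dom_y: "dominating_set G {y, z}" if "z \<in> verts G" "z \<noteq> y" for z
    using that V adj by (auto simp: dominating_set_def)
  have dom_vU: "dominating_set G (insert v U)"
    using V adj by (auto simp: dominating_set_def)
  have lower: "4 \<le> card P" if P: "c_partition G P" for P
  proof -
    have part: "partition_on (verts G) P" using P by (simp add: c_partition_def)
    have xyP: "{x} \<in> P" "{y} \<in> P"
      using c_partition_singleton_part[OF no_universal P] dom_x dom_y V by auto
    obtain W where W: "W \<in> P" "v \<in> W" using part V partition_onD1 by blast
    have other: "X \<inter> {x, y} = {}" "X \<subseteq> verts G" if "X \<in> P" "X \<noteq> {x}" "X \<noteq> {y}" for X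
    proof -
      show "X \<inter> {x, y} = {}"
        using disjointD[OF partition_onD2[OF part] that(1) xyP(1)]
          disjointD[OF partition_onD2[OF part] that(1) xyP(2)] that(2,3) by blast
      show "X \<subseteq> verts G" using partition_onD1[OF part] that(1) by blast
    qed
    have Wne: "W \<noteq> {x}" "W \<noteq> {y}" using W distinct by auto
    have "W \<noteq> insert v U"
      using dom_vU c_partition_part_not_dominating[OF no_universal P W(1)] by auto
    then obtain u where u: "u \<in> U" "u \<notin> W"
      using other[OF W(1) Wne] W(2) V by blast
    then obtain T where T: "T \<in> P" "u \<in> T" using part V partition_onD1 by blast
    have "card {{x}, {y}, W, T} = 4"
      using distinct Wne u T(2) by (auto simp: card_insert_if)
    moreover have "{{x}, {y}, W, T} \<subseteq> P" using xyP W T by blast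
    ultimately show ?thesis
      using card_mono[OF finite_elements[OF finite_verts part]] by metis
  qed
  let ?P = "{{v}, {x}, {y}, U}"
  have part: "partition_on (verts G) ?P"
    using V distinct \<open>U \<noteq> {}\<close> by (intro partition_onI) (auto simp: disjnt_def)
  have card: "card ?P = 4"
    using distinct by (auto simp: card_insert_if)
  have single: "\<not> dominating_set G {z}" for z
    using no_universal dominating_singleton_imp_universal_vertex by blast
  have "closed_neighborhood G v \<inter> U = {}"
    using distinct by (simp add: closed_neighborhood_def Nv)
  moreover have "v \<in> verts G" "U \<subseteq> verts G" using V by auto
  ultimately have "\<not> dominating_set G U"
    using dominating_set_iff_meets_closed_neighborhoods by blast
  moreover have "dominating_set G {x, v}" "dominating_set G {y, v}"
    using dom_x[of v] dom_y[of v] V distinct by auto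
  ultimately have "coalition G {x} {v}" "coalition G {v} {x}"
    "coalition G {y} {v}" "coalition G U {v}"
    using single dom_vU V distinct by (simp_all add: coalition_def insert_commute subset_insertI2)
  moreover have "{v} \<noteq> U" using distinct by blast
  ultimately have "c_partition G ?P"
    using part distinct unfolding c_partition_def by auto
  then have "Inf (card ` {P. c_partition G P}) = 4"
    using lower card by (intro cInf_eq_minimum) force+
  then show ?thesis by (simp add: c_min_eq_least_card_c_partition)
qed

theorem theorem6:
  fixes G :: "('a, 'b) pre_digraph"
  assumes "graph G"
    and "verts G \<noteq> {}"
    and "min_degree G = 2"
    and "\<not> (\<exists>v. universal_vertex G v)"
  shows "c_min G = 4 \<longleftrightarrow> G \<in> family_F"
proof
  interpret graph G by (rule assms(1))
  show "c_min G = 4" if "G \<in> family_F"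
    by (rule c_min_eq_4_if_family_F[OF assms(4) that])
  show "G \<in> family_F" if c4: "c_min G = 4"
  proof -
    have large: "4 \<le> card P" if "c_partition G P" for P
      using that c4 cInf_lower[of "card P" "card ` {P. c_partition G P}"]
      by (simp add: c_min_eq_least_card_c_partition)
    have "2 \<in> degree G ` verts G"
      using Min_in[of "degree G ` verts G"] assms(2,3) finite_verts
      unfolding min_degree_def by (metis finite_imageI image_is_empty)
    then obtain v where "v \<in> verts G" "degree G v = 2" by auto
    then show ?thesis
      using family_F_if_closed_neighborhoods_intersect[OF assms(4)]
        closed_neighborhoods_intersect[OF large] by blast
  qed
qed

end
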